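(* Let $n \in \mathbb{N}$, $n \ge 1$, let $x = (x_1,\ldots,x_n) \in \mathbb{C}^n$, and let $j$ be a nonnegative integer. Let $K_x = D_x C$ and $\alpha_x = \prod_{k=1}^n x_k$. If $q = \lfloor j/n \rfloor$ and $r = j \bmod n$, then $$K_x^j = \alpha_x^q \left( \prod_{i=0}^{r-1} D_{\pi^i(x)} \right) C^r.$$
   Context: $\pi$ is the permutation of $\{1,\ldots,n\}$ given by $\pi(i) = (i \bmod n) + 1$, and $C = C_n$ is the $n$-by-$n$ permutation matrix whose $(i,j)$-entry is $\delta_{\pi(i),j}$ (Kronecker delta). For $z \in \mathbb{C}^n$, $D_z$ is the diagonal matrix whose $k$th diagonal entry is $z_k$. For a permutation $\sigma$ of $\{1,\ldots,n\}$ and $z \in \mathbb{C}^n$, $\sigma(z)$ denotes the vector whose $i$th entry is $z_{\sigma(i)}$; $\pi^i$ denotes the $i$-fold composition of $\pi$. An empty product of matrices equals the identity $I$, zeroth powers of matrices equal $I$, and $\alpha_x^0 = 1$. *)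

theory Defs
  imports Complex_Main "HOL-Combinatorics.Permutations" "Jordan_Normal_Form.Matrix"
begin

text \<open>
  Vectors and matrices are the dynamically sized ones of \<open>Jordan_Normal_Form\<close>, whose indices
  start at 0, whereas permutations here act on \<open>{1..n}\<close>.  Hence the \<open>k\<close>-th entry
  (\<open>1 \<le> k \<le> n\<close>) of \<open>z\<close> is \<open>z $ (k - 1)\<close>, and an entry at the 0-based matrix position
  \<open>(i, j)\<close> is described by the 1-based position \<open>(i + 1, j + 1)\<close>.
\<close>

abbreviation entry :: "complex vec \<Rightarrow> nat \<Rightarrow> complex" where
  "entry z k \<equiv> z $ (k - 1)"

text \<open>Identity outside \<open>{1..n}\<close>, so that it is a permutation of \<open>{1..n}\<close> in the sense of
  \<^const>\<open>permutes\<close>.\<close>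

definition cyc :: "nat \<Rightarrow> nat \<Rightarrow> nat" where
  "cyc n i = (if i \<in> {1..n} then (i mod n) + 1 else i)"

lemma cyc_permutes: "cyc n permutes {1..n}"
proof (rule bij_imp_permutes)
  have "inj_on (cyc n) {1..n}"
  proof (rule inj_onI)
    fix a b assume a: "a \<in> {1..n}" and b: "b \<in> {1..n}" and "cyc n a = cyc n b"
    then have "a mod n = b mod n" by (simp add: cyc_def)
    with a b show "a = b"
      by (cases "a = n"; cases "b = n") auto
  qed
  moreover have "cyc n ` {1..n} \<subseteq> {1..n}"
    by (auto simp: cyc_def Suc_le_eq)
  ultimately show "bij_betw (cyc n) {1..n} {1..n}"
    by (simp add: bij_betw_def endo_inj_surj)
qed (auto simp: cyc_def)

definition C_mat :: "nat \<Rightarrow> complex mat" where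
  "C_mat n = mat n n (\<lambda>(i, j). if cyc n (i + 1) = j + 1 then 1 else 0)"

definition D_mat :: "complex vec \<Rightarrow> complex mat" where
  "D_mat z = mat_diag (dim_vec z) (\<lambda>i. entry z (i + 1))"

definition perm_vec :: "(nat \<Rightarrow> nat) \<Rightarrow> complex vec \<Rightarrow> complex vec" where
  "perm_vec \<sigma> z = vec (dim_vec z) (\<lambda>i. entry z (\<sigma> (i + 1)))"

definition K_mat :: "complex vec \<Rightarrow> complex mat" where
  "K_mat x = D_mat x * C_mat (dim_vec x)"

definition alpha :: "complex vec \<Rightarrow> complex" where
  "alpha x = (\<Prod>k = 1..dim_vec x. entry x k)"

text \<open>The ordered product \<open>f 0 * f 1 * \<dots> * f (r - 1)\<close> of \<open>n \<times> n\<close> matrices; matrices of varying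
  size form no type-class monoid, so \<^const>\<open>prod\<close> and \<^const>\<open>prod_list\<close> do not apply.\<close>

primrec mat_prod :: "nat \<Rightarrow> (nat \<Rightarrow> complex mat) \<Rightarrow> nat \<Rightarrow> complex mat" where
  "mat_prod n f 0 = 1\<^sub>m n"
| "mat_prod n f (Suc r) = mat_prod n f r * f r"

end

theory Submission
  imports Defs
begin

text \<open>
  Diagonal matrices, \<open>C\<close> and \<open>K\<^sub>x\<close> are all weighted cyclic shifts, whose only nonzero entries lie
  at the positions \<open>(a, (a + s) mod n)\<close>, and these are closed under multiplication: offsets add
  and weights multiply after a rotation. Hence row \<open>a\<close> of \<open>K\<^sub>x\<^sup>j\<close> carries the weight
  \<open>x\<^sub>a x\<^sub>a\<^sub>+\<^sub>1 \<dots>\<close> (\<open>j\<close> factors, indices taken cyclically). Each full turn of the cycle contributes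
  \<open>\<alpha>\<^sub>x\<close>, and the remaining \<open>r\<close> factors are the diagonal entries of the product of the
  \<open>D\<close> matrices.
\<close>

text \<open>The offset \<open>s\<close> is left unreduced, so that offsets add as plain naturals
  under multiplication.\<close>

definition shift_mat :: "nat \<Rightarrow> nat \<Rightarrow> (nat \<Rightarrow> complex) \<Rightarrow> complex mat" where
  "shift_mat n s w = mat n n (\<lambda>(a, b). if b = (a + s) mod n then w a else 0)"

lemma dim_shift_mat [simp]:
  "dim_row (shift_mat n s w) = n" "dim_col (shift_mat n s w) = n"
  by (simp_all add: shift_mat_def)

lemma shift_mat_cong:
  assumes "s mod n = t mod n" and "\<And>a. a < n \<Longrightarrow> v a = w a"
  shows "shift_mat n s v = shift_mat n t w"
proof -
  have "(a + s) mod n = (a + t) mod n" for a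
    using assms(1) by (metis mod_add_right_eq)
  then show ?thesis
    using assms(2) by (auto simp: shift_mat_def intro!: eq_matI)
qed

lemma shift_mat_one: "shift_mat n 0 (\<lambda>_. 1) = 1\<^sub>m n"
  by (auto simp: shift_mat_def intro!: eq_matI)

lemma smult_shift_mat: "c \<cdot>\<^sub>m shift_mat n s w = shift_mat n s (\<lambda>a. c * w a)"
  by (auto simp: shift_mat_def intro!: eq_matI)

text \<open>Row \<open>a\<close> of the left factor is nonzero only in column
  \<open>(a + s) mod n\<close>, so the sum in the matrix product collapses to that single
  term.\<close>

lemma shift_mat_mult:
  "shift_mat n s u * shift_mat n t v = shift_mat n (s + t) (\<lambda>a. u a * v ((a + s) mod n))"
proof (rule eq_matI)
  fix a b
  assume "a < dim_row (shift_mat n (s + t) (\<lambda>a. u a * v ((a + s) mod n)))"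
    and "b < dim_col (shift_mat n (s + t) (\<lambda>a. u a * v ((a + s) mod n)))"
  then have ab: "a < n" "b < n" by simp_all
  let ?m = "(a + s) mod n"
  have "(shift_mat n s u * shift_mat n t v) $$ (a, b) =
      (\<Sum>c = 0..<n. (if c = ?m then u a else 0) * (if b = (c + t) mod n then v c else 0))"
    using ab by (simp add: scalar_prod_def shift_mat_def)
  also have "\<dots> = (\<Sum>c = 0..<n. if c = ?m then u a * (if b = (c + t) mod n then v c else 0) else 0)"
    by (intro sum.cong) auto
  also have "\<dots> = u a * (if b = (?m + t) mod n then v ?m else 0)"
    using ab by simp
  also have "\<dots> = shift_mat n (s + t) (\<lambda>a. u a * v ((a + s) mod n)) $$ (a, b)"
    using ab by (simp add: shift_mat_def mod_add_left_eq add.assoc)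
  finally show "(shift_mat n s u * shift_mat n t v) $$ (a, b) =
      shift_mat n (s + t) (\<lambda>a. u a * v ((a + s) mod n)) $$ (a, b)" .
qed simp_all

lemma shift_mat_pow:
  "shift_mat n 1 w ^\<^sub>m k = shift_mat n k (\<lambda>a. \<Prod>i<k. w ((a + i) mod n))"
  by (induction k) (simp_all add: shift_mat_one shift_mat_mult)

lemma mat_prod_shift_mat:
  "mat_prod n (\<lambda>i. shift_mat n 0 (w i)) r = shift_mat n 0 (\<lambda>a. \<Prod>i<r. w i a)"
proof (induction r)
  case (Suc r)
  \<comment> \<open>The product rule leaves a rotation by 0, that is \<open>a mod n\<close>, which
    is harmless because only rows \<open>a < n\<close> occur.\<close>
  have "shift_mat n 0 (\<lambda>a. (\<Prod>i<r. w i a) * w r (a mod n)) =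
      shift_mat n 0 (\<lambda>a. (\<Prod>i<r. w i a) * w r a)"
    by (rule shift_mat_cong) simp_all
  with Suc show ?case by (simp add: shift_mat_mult)
qed (simp add: shift_mat_one)

text \<open>\<open>Suc a\<close> is the 1-based label of the 0-based index \<open>a\<close>; on
  0-based indices the cycle is addition of 1 modulo \<open>n\<close>.\<close>

lemma cyc_funpow:
  assumes "a < n"
  shows "(cyc n ^^ i) (Suc a) = Suc ((a + i) mod n)"
proof (induction i)
  case (Suc i)
  have "cyc n (Suc b) = Suc (Suc b mod n)" if "b < n" for b
    using that by (simp add: cyc_def)
  with Suc assms show ?case by (simp add: mod_Suc_eq)
qed (use assms in simp)

lemma C_mat_eq_shift_mat: "C_mat n = shift_mat n 1 (\<lambda>_. 1)"
  by (auto simp: C_mat_def shift_mat_def cyc_def intro!: eq_matI)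

lemma D_mat_eq_shift_mat:
  assumes "x \<in> carrier_vec n"
  shows "D_mat x = shift_mat n 0 (\<lambda>a. x $ a)"
  using assms by (auto simp: D_mat_def mat_diag_def shift_mat_def intro!: eq_matI)

lemma D_mat_perm_vec_cyc:
  assumes "x \<in> carrier_vec n"
  shows "D_mat (perm_vec (cyc n ^^ i) x) = shift_mat n 0 (\<lambda>a. x $ ((a + i) mod n))"
proof -
  have "perm_vec (cyc n ^^ i) x \<in> carrier_vec n"
    using assms by (simp add: perm_vec_def)
  then have "D_mat (perm_vec (cyc n ^^ i) x) = shift_mat n 0 (\<lambda>a. perm_vec (cyc n ^^ i) x $ a)"
    by (rule D_mat_eq_shift_mat)
  also have "\<dots> = shift_mat n 0 (\<lambda>a. x $ ((a + i) mod n))"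
    using assms by (intro shift_mat_cong) (simp_all add: perm_vec_def cyc_funpow)
  finally show ?thesis .
qed

lemma K_mat_eq_shift_mat:
  assumes "x \<in> carrier_vec n"
  shows "K_mat x = shift_mat n 1 (\<lambda>a. x $ a)"
  using assms by (simp add: K_mat_def D_mat_eq_shift_mat C_mat_eq_shift_mat shift_mat_mult)

text \<open>Raising the starting point by one drops the first factor and appends a last one, and by
  wrap-around these two agree.\<close>

lemma prod_rotate:
  fixes f :: "nat \<Rightarrow> 'a::comm_monoid_mult"
  shows "(\<Prod>i<n. f ((a + i) mod n)) = (\<Prod>i<n. f i)"
proof (induction a)
  case (Suc a)
  have "(\<Prod>i<n. f ((Suc a + i) mod n)) = (\<Prod>i<n. f ((a + i) mod n))"
  proof (cases n)
    case (Suc m)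
    have wrap: "(Suc a + m) mod n = (a + 0) mod n"
      using mod_add_self2[of a n] unfolding Suc by (simp only: add_Suc_right add_Suc add_0_right)
    show ?thesis
      unfolding Suc prod.lessThan_Suc_shift[of "\<lambda>i. f ((a + i) mod Suc m)"]
      using wrap[unfolded Suc]
      by (simp only: prod.lessThan_Suc add_Suc_right add_Suc o_def mult.commute)
  qed simp
  with Suc.IH show ?case by simp
qed simp

text \<open>Splitting off the first \<open>n\<close> factors removes one full turn, whose product
  does not depend on the start \<open>a\<close>; the remaining indices, shifted by \<open>n\<close>,
  are unchanged modulo \<open>n\<close>.\<close>

lemma prod_periodic:
  fixes f :: "nat \<Rightarrow> 'a::comm_monoid_mult"
  shows "(\<Prod>i<q * n + r. f ((a + i) mod n)) = (\<Prod>i<n. f i) ^ q * (\<Prod>i<r. f ((a + i) mod n))"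
proof (induction q)
  case (Suc q)
  have split: "(\<Prod>i<n + m. g i) = (\<Prod>i<n. g i) * (\<Prod>i<m. g (n + i))" for g :: "nat \<Rightarrow> 'a" and m
    by (induction m) (simp_all add: mult.assoc)
  have "(a + (n + i)) mod n = (a + i) mod n" for i
    by (metis add.left_commute mod_add_self1)
  then have "(\<Prod>i<n + (q * n + r). f ((a + i) mod n)) =
      (\<Prod>i<n. f i) * (\<Prod>i<q * n + r. f ((a + i) mod n))"
    by (simp only: split prod_rotate)
  with Suc show ?case by (simp add: add.assoc mult.assoc)
qed simp

lemma alpha_eq:
  assumes "x \<in> carrier_vec n"
  shows "alpha x = (\<Prod>i<n. x $ i)"
  using assms prod.atLeast1_atMost_eq[of "\<lambda>k. x $ (k - 1)" n] by (simp add: alpha_def)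

theorem lemma3p2:
  fixes n j q r :: nat and x :: "complex vec"
  assumes "n \<ge> 1"
    and "x \<in> carrier_vec n"
    and "q = j div n"
    and "r = j mod n"
  shows "K_mat x ^\<^sub>m j =
    alpha x ^ q \<cdot>\<^sub>m (mat_prod n (\<lambda>i. D_mat (perm_vec (cyc n ^^ i) x)) r * C_mat n ^\<^sub>m r)"
proof -
  have j: "j = q * n + r" using assms(3,4) by simp
  have "K_mat x ^\<^sub>m j = shift_mat n j (\<lambda>a. \<Prod>i<j. x $ ((a + i) mod n))"
    by (simp only: K_mat_eq_shift_mat[OF assms(2)] shift_mat_pow)
  \<comment> \<open>The offset \<open>j\<close> becomes \<open>r\<close> because full turns do not
    move the nonzero entries; they survive only as the factor \<open>alpha x ^ q\<close>.\<close>
  also have "\<dots> = shift_mat n r (\<lambda>a. alpha x ^ q * (\<Prod>i<r. x $ ((a + i) mod n)))"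
    unfolding j prod_periodic[of "($) x"] alpha_eq[OF assms(2)] by (rule shift_mat_cong) simp_all
  also have "\<dots> = alpha x ^ q \<cdot>\<^sub>m
      (mat_prod n (\<lambda>i. D_mat (perm_vec (cyc n ^^ i) x)) r * C_mat n ^\<^sub>m r)"
    \<comment> \<open>The diagonal product supplies all the weights at offset 0, while the power of
      \<open>C_mat n\<close> has weights 1 and supplies the offset \<open>r\<close>.\<close>
    unfolding D_mat_perm_vec_cyc[OF assms(2)] mat_prod_shift_mat C_mat_eq_shift_mat shift_mat_pow
    by (simp add: shift_mat_mult smult_shift_mat)
  finally show ?thesis .
qed

end
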